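(* Let $ABC$ be a triangle in the Euclidean plane, and let $AA_1$ with $A_1\in BC$ and $BB_1$ with $B_1\in AC$ be the bisectors of the interior angles $\angle CAB$ and $\angle CBA$, respectively. If $\angle BB_1A_1=30^\circ$, then either $\angle ACB=60^\circ$ or $\angle BAC=120^\circ$ (exclusive disjunction).
   Context: Triangles are non-degenerate. The points $A_1$ and $B_1$ are the points where the bisectors of the interior angles at $A$ and $B$ meet the opposite sides $BC$ and $AC$. *)

theory Defs
  imports "HOL-Analysis.Analysis"
begin

text \<open>The unoriented angle between two vectors, in \<open>[0, pi]\<close>. Since \<open>x / 0 = 0\<close>,
  the value is \<open>pi / 2\<close> when one of the vectors is zero.\<close>

definition vec_angle :: "'a::real_inner \<Rightarrow> 'a \<Rightarrow> real" where
  "vec_angle u v = arccos (inner u v / (norm u * norm v))"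

text \<open>The angle \<open>PQR\<close>; the vertex is the middle argument.\<close>

definition angle :: "'a::real_inner \<Rightarrow> 'a \<Rightarrow> 'a \<Rightarrow> real" where
  "angle P Q R = vec_angle (P - Q) (R - Q)"

text \<open>\<open>D\<close> is the point where the bisector of the interior angle \<open>QPR\<close> meets the opposite
  side \<open>QR\<close>. Requiring \<open>D\<close> to lie on the segment \<open>QR\<close> puts the ray \<open>PD\<close> inside the angle,
  so the exterior bisector is excluded.\<close>

definition interior_bisector_foot :: "'a::real_inner \<Rightarrow> 'a \<Rightarrow> 'a \<Rightarrow> 'a \<Rightarrow> bool" where
  "interior_bisector_foot P Q R D \<longleftrightarrow>
     D \<in> closed_segment Q R \<and> angle Q P D = angle D P R"

end

theory Submission
  imports Defs
begin

text \<open>With the side lengths \<open>a, b, c\<close>, the feet of the bisectors are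
  \<open>A1 = (b B + c C) / (b + c)\<close> and \<open>B1 = (a A + c C) / (a + c)\<close>. The condition
  \<open>angle B B1 A1 = pi / 6\<close> then becomes a polynomial equation in \<open>a, b, c\<close>, and that
  polynomial is the product of \<open>a\<^sup>2 + b\<^sup>2 - c\<^sup>2 - a b\<close>, whose vanishing means \<open>C = pi / 3\<close>,
  of \<open>b\<^sup>2 + c\<^sup>2 - a\<^sup>2 + b c\<close>, whose vanishing means \<open>A = 2 pi / 3\<close>, and of factors that are
  nonzero in a nondegenerate triangle.\<close>

lemma abs_inner_div_norms_le_one: "\<bar>inner u v / (norm u * norm v)\<bar> \<le> 1"
proof (cases "norm u * norm v = 0")
  case False
  then have "norm u * norm v > 0"
    by (simp add: less_le)
  then show ?thesis
    using Cauchy_Schwarz_ineq2[of u v] by (simp add: abs_mult)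
qed auto

text \<open>Zero vectors need no exception: the default angle is pi / 2 and both sides
  vanish.\<close>

lemma cos_vec_angle: "cos (vec_angle u v) = inner u v / (norm u * norm v)"
  unfolding vec_angle_def using abs_inner_div_norms_le_one[of u v] by (intro cos_arccos_abs)

lemma inner_eq_cos_vec_angle: "inner u v = norm u * norm v * cos (vec_angle u v)"
  by (cases "u = 0 \<or> v = 0") (auto simp: cos_vec_angle)

lemma vec_angle_eq_iff_cos:
  assumes "0 \<le> t" "t \<le> pi"
  shows "vec_angle u v = t \<longleftrightarrow> cos (vec_angle u v) = cos t"
proof -
  have "0 \<le> vec_angle u v" "vec_angle u v \<le> pi"
    using arccos_bounded abs_inner_div_norms_le_one[of u v, unfolded abs_le_iff]
    unfolding vec_angle_def by (smt (verit))+
  then show ?thesis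
    using assms cos_inj_pi by metis
qed

text \<open>Write D = (1 - t) Q + t R. Equality of the cosines of the two half angles at P factors
  as \<open>((1 - t) * norm q - t * norm r) * (norm q * norm r - inner q r) = 0\<close>. The second
  factor is positive by strict Cauchy-Schwarz, so the first determines the ratio in which D divides
  QR.\<close>

lemma interior_bisector_foot_barycentric:
  fixes P Q R D :: "'a::euclidean_space"
  assumes nc: "\<not> collinear {P, Q, R}" and foot: "interior_bisector_foot P Q R D"
  shows "(norm (Q - P) + norm (R - P)) *\<^sub>R D = norm (R - P) *\<^sub>R Q + norm (Q - P) *\<^sub>R R"
proof -
  define q r d where "q = Q - P" and "r = R - P" and "d = D - P"
  obtain t where t: "D = (1 - t) *\<^sub>R Q + t *\<^sub>R R"
    using foot unfolding interior_bisector_foot_def closed_segment_def by auto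
  have d: "d = (1 - t) *\<^sub>R q + t *\<^sub>R r"
    unfolding d_def q_def r_def t by (simp add: algebra_simps)
  have nc': "\<not> collinear {0, q, r}"
    using nc collinear_3[of Q P R] unfolding q_def r_def by (simp add: insert_commute)
  then have lt: "inner q r < norm q * norm r"
    using norm_cauchy_schwarz[of q r] norm_cauchy_schwarz_equal[of q r] by (smt (verit) norm_ge_zero mult_nonneg_nonneg)
  have "q \<noteq> 0" "r \<noteq> 0"
    using nc' by (auto simp: insert_commute)
  \<comment> \<open>For D = P both half angles would take the default value pi / 2, and their
    equality would carry no information.\<close>
  have "d \<noteq> 0"
  proof
    assume "d = 0"
    then have "D = P" by (simp add: d_def)
    then have "P \<in> closed_segment Q R"
      using foot unfolding interior_bisector_foot_def by simp
    then have "collinear {Q, P, R}"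
      using between_imp_collinear between_mem_segment by blast
    with nc show False by (simp add: insert_commute)
  qed
  have "vec_angle q d = vec_angle d r"
    using foot unfolding interior_bisector_foot_def angle_def q_def r_def d_def by simp
  then have "inner q d / (norm q * norm d) = inner d r / (norm d * norm r)"
    using cos_vec_angle by metis
  then have "inner q d * norm r = inner d r * norm q"
    using \<open>q \<noteq> 0\<close> \<open>r \<noteq> 0\<close> \<open>d \<noteq> 0\<close> by (simp add: field_simps)
  moreover have "inner q d = (1 - t) * (norm q)\<^sup>2 + t * inner q r"
    "inner d r = (1 - t) * inner q r + t * (norm r)\<^sup>2"
    by (simp_all add: d inner_add_left inner_add_right power2_norm_eq_inner)
  ultimately have "((1 - t) * norm q - t * norm r) * (norm q * norm r - inner q r) = 0"
    by algebra
  then have ratio: "(1 - t) * norm q = t * norm r"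
    using lt by simp
  have "(norm q + norm r) *\<^sub>R D = ((norm q + norm r) * (1 - t)) *\<^sub>R Q + ((norm q + norm r) * t) *\<^sub>R R"
    unfolding t by (simp add: scaleR_add_right)
  also have "(norm q + norm r) * (1 - t) = norm r"
    using ratio by (simp add: algebra_simps)
  also have "(norm q + norm r) * t = norm q"
    using ratio by (simp add: algebra_simps)
  finally show ?thesis
    unfolding q_def r_def .
qed

lemma law_of_cosines:
  "2 * inner (P - Q) (R - Q) = (norm (P - Q))\<^sup>2 + (norm (R - Q))\<^sup>2 - (norm (P - R))\<^sup>2"
  by (simp add: power2_norm_eq_inner inner_diff_left inner_diff_right inner_commute)

text \<open>Here \<open>p\<close> stands for the inner product of the sides CA and CB, and the left
  side is the squared angle condition without its factor a^2.\<close>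

lemma bisector_angle_polynomial_factorization:
  fixes a b c p :: real
  assumes "2 * p = a\<^sup>2 + b\<^sup>2 - c\<^sup>2"
  shows "(a * b * (a + c)\<^sup>2 - (a + c) * (2 * b + c) * p + a * b\<^sup>2 * (b + c))\<^sup>2
           - 3 * ((a + c) * c)\<^sup>2 * (a\<^sup>2 * b\<^sup>2 - p\<^sup>2)
         = c\<^sup>2 * (a + c - b) * (a + b + c) * (a * b - 2 * p) * (b\<^sup>2 + c\<^sup>2 - a\<^sup>2 + b * c)"
proof -
  have p: "p = (a\<^sup>2 + b\<^sup>2 - c\<^sup>2) / 2" using assms by simp
  show ?thesis unfolding p by (simp add: field_simps) algebra
qed

text \<open>The vectors \<open>x\<close> and \<open>y\<close> are \<open>B - B1\<close> and \<open>A1 - B1\<close> up to positive factors,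
  with the origin at \<open>C\<close>.\<close>

lemma bisector_angle_condition:
  fixes u v :: "'a::real_inner" and c :: real
  defines "a \<equiv> norm v" and "b \<equiv> norm u"
  defines "x \<equiv> (a + c) *\<^sub>R v - a *\<^sub>R u" and "y \<equiv> (b * (a + c)) *\<^sub>R v - (a * (b + c)) *\<^sub>R u"
  shows "4 * (inner x y)\<^sup>2 - 3 * (norm x)\<^sup>2 * (norm y)\<^sup>2
    = a\<^sup>2 * ((a * b * (a + c)\<^sup>2 - (a + c) * (2 * b + c) * inner u v + a * b\<^sup>2 * (b + c))\<^sup>2
           - 3 * ((a + c) * c)\<^sup>2 * (a\<^sup>2 * b\<^sup>2 - (inner u v)\<^sup>2))"
proof -
  have uu: "inner u u = b\<^sup>2" and vv: "inner v v = a\<^sup>2" and vu: "inner v u = inner u v"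
    by (simp_all add: a_def b_def power2_norm_eq_inner inner_commute)
  have xy: "inner x y = (a + c) * b * (a + c) * a\<^sup>2 - ((a + c) * a * (b + c) + a * b * (a + c)) * inner u v
      + a * a * (b + c) * b\<^sup>2"
    unfolding x_def y_def inner_diff_left inner_diff_right inner_scaleR_left inner_scaleR_right uu vv vu
    by algebra
  have xx: "(norm x)\<^sup>2 = (a + c)\<^sup>2 * a\<^sup>2 - 2 * (a + c) * a * inner u v + a\<^sup>2 * b\<^sup>2"
    unfolding power2_norm_eq_inner x_def y_def inner_diff_left inner_diff_right inner_scaleR_left inner_scaleR_right uu vv vu
    by algebra
  have yy: "(norm y)\<^sup>2 = b\<^sup>2 * (a + c)\<^sup>2 * a\<^sup>2 - 2 * b * (a + c) * a * (b + c) * inner u v + a\<^sup>2 * (b + c)\<^sup>2 * b\<^sup>2"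
    unfolding power2_norm_eq_inner x_def y_def inner_diff_left inner_diff_right inner_scaleR_left inner_scaleR_right uu vv vu
    by algebra
  \<comment> \<open>The left side is \<open>(inner x y)^2\<close> minus three times the Gram
    determinant of \<open>x\<close> and \<open>y\<close>. That determinant is the one of
    \<open>u\<close> and \<open>v\<close> times the square of the coefficient determinant, which is
    a (a + c) c up to sign. The other term is a square because \<open>inner x y\<close> is divisible
    by \<open>a\<close>.\<close>
  show ?thesis
    unfolding xy xx yy by algebra
qed

theorem mainTheorem3:
  fixes A B C A1 B1 :: "real ^ 2"
  assumes triangle: "\<not> collinear {A, B, C}"
    and A1: "interior_bisector_foot A B C A1"
    and B1: "interior_bisector_foot B A C B1"
    and angle_30: "angle B B1 A1 = pi / 6"
  shows "(angle A C B = pi / 3 \<or> angle B A C = 2 * pi / 3) \<and>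
         \<not> (angle A C B = pi / 3 \<and> angle B A C = 2 * pi / 3)"
proof -
  define u v where "u = A - C" and "v = B - C"
  define a b c where "a = norm v" and "b = norm u" and "c = norm (A - B)"
  have "A \<noteq> B" "A \<noteq> C" "B \<noteq> C"
    using triangle by (auto simp: insert_commute)
  then have pos: "a > 0" "b > 0" "c > 0"
    by (auto simp: a_def b_def c_def u_def v_def)
  have norms: "norm (B - A) = c" "norm (C - A) = b" "norm (C - B) = a"
    by (simp_all add: a_def b_def c_def u_def v_def norm_minus_commute)
  have "\<not> collinear {B, A, C}"
    using triangle by (simp add: insert_commute)
  from interior_bisector_foot_barycentric[OF this B1]
  have fB: "(a + c) *\<^sub>R B1 = a *\<^sub>R A + c *\<^sub>R C"
    by (simp add: norms flip: c_def) (simp add: add.commute)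
  from interior_bisector_foot_barycentric[OF triangle A1]
  have fA: "(b + c) *\<^sub>R A1 = b *\<^sub>R B + c *\<^sub>R C"
    by (simp add: norms add.commute)

  define x y where "x = (a + c) *\<^sub>R v - a *\<^sub>R u" and "y = (b * (a + c)) *\<^sub>R v - (a * (b + c)) *\<^sub>R u"
  have x: "x = (a + c) *\<^sub>R (B - B1)"
    unfolding x_def u_def v_def scaleR_diff_right[of "a + c" B B1] fB by (simp add: algebra_simps)
  \<comment> \<open>The factors are grouped so that \<open>fA\<close> and \<open>fB\<close>
    eliminate both feet.\<close>
  have "((a + c) * (b + c)) *\<^sub>R (A1 - B1)
      = (a + c) *\<^sub>R ((b + c) *\<^sub>R A1) - (b + c) *\<^sub>R ((a + c) *\<^sub>R B1)"
    by (simp add: scaleR_diff_right mult.commute)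
  then have y: "y = ((a + c) * (b + c)) *\<^sub>R (A1 - B1)"
    unfolding fA fB y_def u_def v_def by (simp add: algebra_simps)

  have "inner (B - B1) (A1 - B1) = norm (B - B1) * norm (A1 - B1) * (sqrt 3 / 2)"
    using inner_eq_cos_vec_angle[of "B - B1" "A1 - B1"] angle_30[unfolded angle_def]
    by (simp only: cos_30)
  then have "inner x y = norm x * norm y * (sqrt 3 / 2)"
    using pos by (simp add: x y)
  \<comment> \<open>Squaring also admits the angle 5 pi / 6, which is harmless since only this
    implication is used.\<close>
  then have "4 * (inner x y)\<^sup>2 = 3 * (norm x)\<^sup>2 * (norm y)\<^sup>2"
    by (simp only: power_mult_distrib power_divide) simp
  then have "a\<^sup>2 * ((a * b * (a + c)\<^sup>2 - (a + c) * (2 * b + c) * inner u v + a * b\<^sup>2 * (b + c))\<^sup>2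
           - 3 * ((a + c) * c)\<^sup>2 * (a\<^sup>2 * b\<^sup>2 - (inner u v)\<^sup>2)) = 0"
    using bisector_angle_condition[of v c u, folded a_def b_def, folded x_def y_def] by simp
  moreover have cosC: "2 * inner u v = a\<^sup>2 + b\<^sup>2 - c\<^sup>2"
    using law_of_cosines[of A C B] by (simp add: a_def b_def c_def u_def v_def)
  ultimately have "c\<^sup>2 * (a + c - b) * (a + b + c) * (a * b - 2 * inner u v)
      * (b\<^sup>2 + c\<^sup>2 - a\<^sup>2 + b * c) = 0"
    using bisector_angle_polynomial_factorization[OF cosC] pos by simp
  \<comment> \<open>The strict triangle inequality makes the factor \<open>a + c - b\<close>
    nonzero; equality would put B between A and C.\<close>
  moreover have "b < a + c"
  proof -
    have "a + c \<noteq> b"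
    proof
      assume "a + c = b"
      then have "norm (A - C) = norm (A - B) + norm (B - C)"
        by (simp add: a_def b_def c_def u_def v_def)
      then have "between (A, C) B"
        by (simp add: between dist_norm)
      then have "collinear {A, B, C}"
        by (rule between_imp_collinear)
      with triangle show False ..
    qed
    moreover have "b \<le> a + c"
      using norm_triangle_ineq[of "A - B" "B - C"] by (simp add: a_def b_def c_def u_def v_def)
    ultimately show ?thesis by simp
  qed
  ultimately have key: "2 * inner u v = a * b \<or> b\<^sup>2 + c\<^sup>2 - a\<^sup>2 + b * c = 0"
    using pos by auto

  have "angle A C B = pi / 3 \<longleftrightarrow> inner u v / (b * a) = 1 / 2"
    using vec_angle_eq_iff_cos[of "pi / 3" u v]
    by (simp add: angle_def cos_60 cos_vec_angle flip: u_def v_def a_def b_def)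
  then have C: "angle A C B = pi / 3 \<longleftrightarrow> 2 * inner u v = a * b"
    using pos by (auto simp: field_simps)
  have "angle B A C = 2 * pi / 3 \<longleftrightarrow> inner (B - A) (C - A) / (c * b) = - 1 / 2"
    using vec_angle_eq_iff_cos[of "2 * pi / 3" "B - A" "C - A"]
    by (simp add: angle_def cos_120 cos_vec_angle norms)
  moreover have "2 * inner (B - A) (C - A) = b\<^sup>2 + c\<^sup>2 - a\<^sup>2"
    using law_of_cosines[of B A C] norms by (simp add: a_def v_def)
  ultimately have A: "angle B A C = 2 * pi / 3 \<longleftrightarrow> b\<^sup>2 + c\<^sup>2 - a\<^sup>2 + b * c = 0"
    using pos by (auto simp: field_simps)
  \<comment> \<open>Geometrically, the angles at A and C would already add up to pi. Algebraically,
    substituting c^2 = a^2 + b^2 - a b into the second equation leaves b (2 b + c - a) = 0, against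
    a \<le> b + c.\<close>
  have "\<not> (2 * inner u v = a * b \<and> b\<^sup>2 + c\<^sup>2 - a\<^sup>2 + b * c = 0)"
  proof
    assume "2 * inner u v = a * b \<and> b\<^sup>2 + c\<^sup>2 - a\<^sup>2 + b * c = 0"
    then have "b * (2 * b + c - a) = 0"
      using cosC by algebra
    then have "a = 2 * b + c"
      using pos by simp
    moreover have "a \<le> b + c"
      using norm_triangle_ineq[of "B - A" "A - C"] norms by (simp add: a_def b_def u_def v_def)
    ultimately show False
      using pos by simp
  qed
  with key A C show ?thesis by blast
qed

end
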